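(* Let $n,k,d$ be integers with $n>d\geq 0$ and $k\geq 1$, and let $G$ be an $(n,k,d)$-graph. Then for any pair of distinct non-adjacent vertices $x,y$ of $G$, the graph $G\cup e$ obtained from $G$ by adding the edge $e=xy$ is an $(n,k-1,d)$-graph.
   Context: All graphs are finite, undirected and simple. A $k$-matching is a matching with exactly $k$ edges. For a non-negative integer $d$, a defect-$d$ matching of a graph $H$ is a matching covering exactly $|V(H)|-d$ vertices of $H$. A matching $M$ extends to a matching $M'$ if $M\subseteq M'$. Let $n,k,d$ be non-negative integers. A graph $G$ is an $(n,k,d)$-graph if $|V(G)|\geq n+2k+d+2$, $|V(G)|-n-d$ is even, and for every set $S$ of $n$ vertices of $G$, the graph $H=G-S$ contains a $k$-matching and every $k$-matching of $H$ can be extended to a defect-$d$ matching of $H$. *)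

theory Defs
  imports Main
begin

text \<open>A graph is a pair of a vertex set and a set of edges, an edge being the set of its two ends.\<close>

type_synonym 'a ugraph = "'a set \<times> 'a set set"

abbreviation verts :: "'a ugraph \<Rightarrow> 'a set" where
  "verts G \<equiv> fst G"

abbreviation edges :: "'a ugraph \<Rightarrow> 'a set set" where
  "edges G \<equiv> snd G"

definition simple_graph :: "'a ugraph \<Rightarrow> bool" where
  "simple_graph G \<longleftrightarrow>
     finite (verts G) \<and> (\<forall>e\<in>edges G. e \<subseteq> verts G \<and> card e = 2)"

definition delete_verts :: "'a ugraph \<Rightarrow> 'a set \<Rightarrow> 'a ugraph" where
  "delete_verts G S = (verts G - S, {e \<in> edges G. e \<inter> S = {}})"

definition add_edge :: "'a ugraph \<Rightarrow> 'a \<Rightarrow> 'a \<Rightarrow> 'a ugraph" where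
  "add_edge G x y = (verts G, insert {x, y} (edges G))"

definition matching :: "'a ugraph \<Rightarrow> 'a set set \<Rightarrow> bool" where
  "matching G M \<longleftrightarrow> M \<subseteq> edges G \<and> pairwise disjnt M"

definition k_matching :: "nat \<Rightarrow> 'a ugraph \<Rightarrow> 'a set set \<Rightarrow> bool" where
  "k_matching k G M \<longleftrightarrow> matching G M \<and> card M = k"

text \<open>The number of covered vertices is stated additively to avoid truncated subtraction:
  no matching has defect \<open>d\<close> when the graph has fewer than \<open>d\<close> vertices.\<close>

definition defect_matching :: "nat \<Rightarrow> 'a ugraph \<Rightarrow> 'a set set \<Rightarrow> bool" where
  "defect_matching d G M \<longleftrightarrow> matching G M \<and> card (\<Union>M) + d = card (verts G)"

text \<open>The lower bound on the number of vertices makes the subtractions in the parity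
  condition exact.\<close>

definition nkd_graph :: "nat \<Rightarrow> nat \<Rightarrow> nat \<Rightarrow> 'a ugraph \<Rightarrow> bool" where
  "nkd_graph n k d G \<longleftrightarrow>
     simple_graph G \<and>
     card (verts G) \<ge> n + 2 * k + d + 2 \<and>
     even (card (verts G) - n - d) \<and>
     (\<forall>S. S \<subseteq> verts G \<and> card S = n \<longrightarrow>
        (\<exists>M. k_matching k (delete_verts G S) M) \<and>
        (\<forall>M. k_matching k (delete_verts G S) M \<longrightarrow>
           (\<exists>M'. defect_matching d (delete_verts G S) M' \<and> M \<subseteq> M')))"

end

theory Submission
  imports Defs
begin

text \<open>Let \<open>M\<close> be a matching of \<open>G \<union> e - S\<close> with \<open>k - 1\<close> edges. If \<open>e \<notin> M\<close>, it extends because every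
  \<open>(n,k,d)\<close>-graph is an \<open>(n,j,d)\<close>-graph for \<open>j \<le> k\<close>. Otherwise delete the ends of \<open>M - {e}\<close>; in the
  remaining graph \<open>F\<close> on \<open>V\<close>, matchings of at most two edges still extend to defect \<open>d\<close> after the
  deletion of any \<open>n\<close> vertices, and \<open>F - X\<close> must be shown to have defect at most \<open>d\<close> for
  \<open>X = S \<union> {x,y}\<close>.

  If this fails, take a largest set \<open>U\<close> of at least \<open>n + 2\<close> vertices such that every matching of
  \<open>F - U\<close> misses at least \<open>r = |U| + d - n\<close> vertices. By maximality every vertex of \<open>W = V - U\<close> is
  missed by a matching of \<open>F - U\<close> missing exactly \<open>r\<close>. As in Gallai's lemma, ``equal or never missed
  together by such a matching'' is then an equivalence relation on \<open>W\<close> with exactly \<open>r\<close> classes, all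
  odd, and no edges between different classes; this replaces the Tutte--Berge formula. Extending
  single edges shows that \<open>U\<close> is independent, and extending pairs of edges shows that the edges
  between \<open>U\<close> and a class form a star. Since \<open>r < |U|\<close>, one can delete \<open>n\<close> vertices, star centres
  being deleted first, so that the isolated vertices of \<open>U\<close> and the classes whose star is centred
  in \<open>U\<close> force a defect larger than \<open>d\<close>.\<close>

section \<open>Matchings inside a vertex set: counting and exchange\<close>

lemma card_exchange:
  assumes "finite L" "f \<in> L" "e \<notin> L"
  shows "card (insert e (L - {f})) = card L"
  using assms card_Suc_Diff1[OF assms(1,2)] by (simp del: card_Diff_insert)

text \<open>Extremal choice for the two exchange arguments below, each of which contradicts it by
  swapping one more edge of \<open>M\<close> into \<open>L\<close>.\<close>

lemma max_overlap:
  assumes "finite M" "Q L0"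
  obtains L where "Q L" "\<And>L'. Q L' \<Longrightarrow> card (M \<inter> L') \<le> card (M \<inter> L)"
proof -
  have "\<exists>L. Q L \<and> (\<forall>L'. Q L' \<longrightarrow> card (M \<inter> L') \<le> card (M \<inter> L))"
  proof (rule ex_has_greatest_nat)
    show "Q L0" by (rule assms)
    show "\<forall>L'. Q L' \<longrightarrow> card (M \<inter> L') < Suc (card M)"
      using assms(1) by (simp add: card_mono less_Suc_eq_le)
  qed
  then show ?thesis using that by blast
qed

locale edge_system =
  fixes E :: "'a set set"
  assumes card_edge: "e \<in> E \<Longrightarrow> card e = 2"
begin

text \<open>Deleting vertices only shrinks \<open>W\<close>; the edge set \<open>E\<close> stays
  fixed throughout.\<close>

definition matching_in :: "'a set \<Rightarrow> 'a set set \<Rightarrow> bool" where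
  "matching_in W M \<longleftrightarrow> M \<subseteq> E \<and> pairwise disjnt M \<and> \<Union>M \<subseteq> W"

lemma matching_inD:
  assumes "matching_in W M"
  shows "\<And>e. e \<in> M \<Longrightarrow> e \<in> E" "\<And>e. e \<in> M \<Longrightarrow> e \<subseteq> W"
    "\<And>e f v. \<lbrakk>e \<in> M; f \<in> M; v \<in> e; v \<in> f\<rbrakk> \<Longrightarrow> e = f"
  using assms unfolding matching_in_def pairwise_def disjnt_def by blast+

lemma matching_in_mono:
  assumes "matching_in W M" "N \<subseteq> M" "\<Union>N \<subseteq> W'"
  shows "matching_in W' N"
  using assms unfolding matching_in_def by (auto intro: pairwise_subset)

lemma matching_in_subset: "\<lbrakk>matching_in W M; N \<subseteq> M\<rbrakk> \<Longrightarrow> matching_in W N"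
  unfolding matching_in_def by (auto intro: pairwise_subset)

lemma matching_in_Un:
  assumes "matching_in W M" "matching_in (W - \<Union>M) N"
  shows "matching_in W (M \<union> N)"
proof -
  have "disjnt e f" "disjnt f e" if "e \<in> M" "f \<in> N" for e f
    using that assms(2) unfolding matching_in_def disjnt_def by blast+
  then show ?thesis
    using assms unfolding matching_in_def pairwise_def by auto
qed

lemma edge_obtain:
  assumes "e \<in> E" "v \<in> e"
  obtains w where "e = {v, w}" "w \<noteq> v"
proof -
  obtain a b where "e = {a, b}" "a \<noteq> b"
    using card_edge[OF assms(1)] by (auto simp: card_2_iff)
  then show ?thesis using assms(2) that by auto
qed

lemma finite_edge: "e \<in> E \<Longrightarrow> finite e"
  using card_edge by (metis card.infinite zero_neq_numeral)

lemma finite_matching: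
  assumes "matching_in W M" "finite W"
  shows "finite M"
  using assms unfolding matching_in_def by (meson finite_UnionD finite_subset)

lemma matching_in_insert:
  assumes "matching_in W M" "e \<in> E" "e \<subseteq> W" "e \<inter> \<Union>M = {}"
  shows "matching_in W (insert e M)"
  using assms unfolding matching_in_def by (auto simp: pairwise_insert disjnt_def)

lemma card_Union_matching:
  assumes "matching_in W M" "finite W"
  shows "card (\<Union>M) = 2 * card M"
proof -
  have "card (\<Union>M) = sum card M"
    using assms finite_edge unfolding matching_in_def
    by (intro card_Union_disjoint) auto
  also have "\<dots> = (\<Sum>e\<in>M. 2)"
    using assms card_edge unfolding matching_in_def by (intro sum.cong) auto
  finally show ?thesis by simp
qed

lemma card_missed:
  assumes "matching_in W M" "finite W"
  shows "card (W - \<Union>M) + 2 * card M = card W"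
proof -
  have sub: "\<Union>M \<subseteq> W" using assms(1) by (simp add: matching_in_def)
  then have "card (W - \<Union>M) = card W - card (\<Union>M)"
    using assms(2) by (intro card_Diff_subset) (auto dest: finite_subset)
  moreover have "card (\<Union>M) \<le> card W" using assms(2) sub by (rule card_mono)
  ultimately show ?thesis using card_Union_matching[OF assms] by simp
qed

lemma disjoint_matchings:
  assumes "matching_in (W - \<Union>M) N"
  shows "M \<inter> N = {}"
proof (rule ccontr)
  assume "M \<inter> N \<noteq> {}"
  then obtain e where e: "e \<in> M" "e \<in> N" by blast
  then have "e \<subseteq> W - \<Union>M" "e \<in> E" using matching_inD[OF assms] by blast+
  then have "e = {}" using e by blast
  then show False using card_edge[OF \<open>e \<in> E\<close>] by simp
qed

lemma even_card_of_covered: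
  assumes M: "matching_in W M" "finite W" and C: "C \<subseteq> \<Union>M"
    and closed: "\<And>e. \<lbrakk>e \<in> M; e \<inter> C \<noteq> {}\<rbrakk> \<Longrightarrow> e \<subseteq> C"
  shows "even (card C)"
proof -
  have "matching_in W {e \<in> M. e \<subseteq> C}"
    using matching_in_subset[OF M(1)] by simp
  moreover have "\<Union>{e \<in> M. e \<subseteq> C} = C"
  proof
    show "C \<subseteq> \<Union>{e \<in> M. e \<subseteq> C}"
    proof
      fix v assume v: "v \<in> C"
      then obtain e where e: "e \<in> M" "v \<in> e" using C by blast
      then have "e \<subseteq> C" using closed[OF e(1)] v by blast
      then show "v \<in> \<Union>{e \<in> M. e \<subseteq> C}" using e by blast
    qed
  qed blast
  ultimately show ?thesis
    using card_Union_matching[of W "{e \<in> M. e \<subseteq> C}"] M(2) by simp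
qed

text \<open>Take a matching of size \<open>Suc (card M)\<close> sharing as many edges with
  \<open>M\<close> as possible. If it left a vertex of \<open>\<Union>M\<close> uncovered, the edge
  of \<open>M\<close> there could replace one of its edges outside \<open>M\<close>.\<close>

lemma matching_cover_extend:
  assumes M: "matching_in W M" and N: "matching_in W N" and W: "finite W"
    and lt: "card M < card N"
  obtains M' where "matching_in W M'" "card M' = Suc (card M)" "\<Union>M \<subseteq> \<Union>M'"
proof -
  define Q where "Q L \<longleftrightarrow> matching_in W L \<and> card L = Suc (card M)" for L
  obtain N0 where "N0 \<subseteq> N" "card N0 = Suc (card M)"
    using lt by (meson Suc_leI obtain_subset_with_card_n)
  then have QN0: "Q N0"
    using matching_in_subset[OF N] unfolding Q_def by simp
  have finM: "finite M" using M W by (rule finite_matching)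
  obtain L where L: "Q L" and
    Lmax: "\<And>L'. Q L' \<Longrightarrow> card (M \<inter> L') \<le> card (M \<inter> L)"
    using max_overlap[of M Q, OF finM QN0] by blast
  have mL: "matching_in W L" and cL: "card L = Suc (card M)" using L Q_def by auto
  have finL: "finite L" using mL W by (rule finite_matching)
  have "\<Union>M \<subseteq> \<Union>L"
  proof (rule ccontr)
    assume "\<not> \<Union>M \<subseteq> \<Union>L"
    then obtain v e where v: "v \<in> e" "e \<in> M" "v \<notin> \<Union>L" by blast
    obtain w where w: "e = {v, w}" "w \<noteq> v"
      using edge_obtain[OF matching_inD(1)[OF M v(2)] v(1)] by blast
    \<comment> \<open>The edge to drop is the one of \<open>L\<close> at \<open>w\<close>; if there
      is none, any edge of \<open>L\<close> outside \<open>M\<close> will do, and one exists because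
      \<open>L\<close> is larger than \<open>M\<close>.\<close>
    have "\<exists>f \<in> L - M. e \<inter> \<Union>(L - {f}) = {}"
    proof (cases "w \<in> \<Union>L")
      case True
      then obtain f where f: "f \<in> L" "w \<in> f" by blast
      have "f \<notin> M" using matching_inD(3)[OF M, of f e w] f v w by auto
      moreover have "e \<inter> \<Union>(L - {f}) = {}"
        using matching_inD(3)[OF mL f(1) _ f(2)] v(3) w by auto
      ultimately show ?thesis using f by blast
    next
      case False
      have "\<not> L \<subseteq> M" using card_mono[OF finM, of L] cL by auto
      then obtain f where "f \<in> L - M" by blast
      moreover have "e \<inter> \<Union>(L - {f}) = {}" using False v(3) w by auto
      ultimately show ?thesis by blast
    qed
    then obtain f where f: "f \<in> L" "f \<notin> M" and dis: "e \<inter> \<Union>(L - {f}) = {}" by blast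
    have eL: "e \<notin> L" using v by blast
    let ?L = "insert e (L - {f})"
    have "matching_in W (L - {f})"
      using mL by (rule matching_in_subset) blast
    then have "matching_in W ?L"
      using dis matching_inD(1,2)[OF M v(2)] by (intro matching_in_insert) auto
    moreover have "card ?L = Suc (card M)"
      using card_exchange[OF finL f(1) eL] cL by simp
    ultimately have "card (M \<inter> ?L) \<le> card (M \<inter> L)" using Lmax Q_def by blast
    moreover have "M \<inter> ?L = insert e (M \<inter> L)" using f v by blast
    ultimately show False using eL finM by simp
  qed
  then show ?thesis using that mL cL by blast
qed

text \<open>Exchange towards a matching that overlaps \<open>M\<close> as much as possible, as in the proof of
  Gallai's lemma.\<close>

lemma missed_pair_exchange:
  assumes W: "finite W"
    and min: "\<And>M. matching_in W M \<Longrightarrow> r \<le> card (W - \<Union>M)"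
    and M: "matching_in W M" "card (W - \<Union>M) = r" and a: "a \<in> W - \<Union>M" and c: "c \<in> W - \<Union>M"
    and ac: "a \<noteq> c"
    and N: "matching_in W N" "card (W - \<Union>N) = r" and b: "b \<in> W - \<Union>N"
  obtains L where "matching_in W L" "card (W - \<Union>L) = r" "b \<in> W - \<Union>L"
    "a \<in> W - \<Union>L \<or> c \<in> W - \<Union>L"
proof -
  define Q where "Q L \<longleftrightarrow> matching_in W L \<and> card (W - \<Union>L) = r \<and> b \<in> W - \<Union>L" for L
  have finM: "finite M" using M(1) W by (rule finite_matching)
  have "Q N" using N b Q_def by auto
  then obtain L where L: "Q L" and
    Lmax: "\<And>L'. Q L' \<Longrightarrow> card (M \<inter> L') \<le> card (M \<inter> L)"
    using max_overlap[of M Q, OF finM] by blast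
  have mL: "matching_in W L" and cL: "card (W - \<Union>L) = r" and bL: "b \<in> W - \<Union>L"
    using L Q_def by auto
  have finL: "finite L" using mL W by (rule finite_matching)
  have "a \<in> W - \<Union>L \<or> c \<in> W - \<Union>L"
  proof (rule ccontr)
    assume ccon: "\<not> ?thesis"
    let ?A = "W - \<Union>M" and ?B = "W - \<Union>L"
    \<comment> \<open>Both matchings miss \<open>r\<close> vertices. As \<open>a\<close> and
      \<open>c\<close> are missed by \<open>M\<close> only, at least two vertices are missed by
      \<open>L\<close> only, and one of them differs from \<open>b\<close>.\<close>
    have "card (?A - ?B) = card (?B - ?A)"
      using M(2) cL W by (metis card_le_sym_Diff finite_Diff le_antisym order_refl)
    moreover have "card {a, c} \<le> card (?A - ?B)"
      using a c ccon W by (intro card_mono) auto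
    ultimately have "card (?B - ?A) > card {b}" using ac by simp
    then have "\<not> ?B - ?A \<subseteq> {b}"
      by (meson card_mono finite.emptyI finite.insertI not_less)
    then obtain x where x: "x \<in> W" "x \<notin> \<Union>L" "x \<in> \<Union>M" "x \<noteq> b" by blast
    then obtain e where e: "e \<in> M" "x \<in> e" by blast
    obtain y where y: "e = {x, y}" "y \<noteq> x"
      using edge_obtain[OF matching_inD(1)[OF M(1) e(1)] e(2)] by blast
    have eE: "e \<in> E" "e \<subseteq> W" using matching_inD(1,2)[OF M(1) e(1)] .
    have eL: "e \<notin> L" using x e by blast
    have "y \<in> \<Union>L"
    proof (rule ccontr)
      assume "y \<notin> \<Union>L"
      then have "e \<inter> \<Union>L = {}" using x y by auto
      then have m: "matching_in W (insert e L)" using mL eE by (intro matching_in_insert)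
      from card_missed[OF m W] card_missed[OF mL W] min[OF m] cL finL eL show False by simp
    qed
    then obtain f where f: "f \<in> L" "y \<in> f" by blast
    have fM: "f \<notin> M" using matching_inD(3)[OF M(1), of f e y] f e y eL by auto
    have dis: "e \<inter> \<Union>(L - {f}) = {}"
      using matching_inD(3)[OF mL f(1) _ f(2)] x(2) y by auto
    let ?L = "insert e (L - {f})"
    have "matching_in W (L - {f})"
      using mL by (rule matching_in_subset) blast
    then have m: "matching_in W ?L"
      using dis eE by (intro matching_in_insert) auto
    have "card ?L = card L" using card_exchange[OF finL f(1) eL] .
    then have "card (W - \<Union>?L) = r"
      using card_missed[OF m W] card_missed[OF mL W] cL by simp
    moreover have "b \<notin> \<Union>?L" using bL f x y by auto
    ultimately have "Q ?L" using m bL Q_def by auto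
    then have "card (M \<inter> ?L) \<le> card (M \<inter> L)" using Lmax by blast
    moreover have "M \<inter> ?L = insert e (M \<inter> L)" using fM e by blast
    ultimately show False using eL finM by simp
  qed
  then show ?thesis using that mL cL bL by blast
qed

section \<open>Barriers and restrictions of matchings\<close>

text \<open>The easy half of the Tutte--Berge formula. An odd \<open>C\<close> is not a union of
  edges of \<open>M\<close>, so it contains a missed vertex or is joined by an edge of
  \<open>M\<close> to a vertex of \<open>R\<close>. Distinct members of \<open>\<C>\<close> have
  distinct witnesses.\<close>

lemma barrier_bound:
  assumes M: "matching_in H M" and H: "finite H" and R: "R \<subseteq> H"
    and sub: "\<And>C. C \<in> \<C> \<Longrightarrow> C \<subseteq> H - R" and odd: "\<And>C. C \<in> \<C> \<Longrightarrow> odd (card C)"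
    and dis: "pairwise disjnt \<C>"
    and sep: "\<And>e C. \<lbrakk>e \<in> E; e \<subseteq> H; C \<in> \<C>; e \<inter> C \<noteq> {}\<rbrakk> \<Longrightarrow> e \<subseteq> C \<or> e \<inter> R \<noteq> {}"
  shows "card \<C> \<le> card R + card (H - \<Union>M)"
proof -
  have "\<exists>w \<in> R \<union> (H - \<Union>M). w \<in> C \<or> w \<in> R \<and> (\<exists>e\<in>M. w \<in> e \<and> e \<inter> C \<noteq> {})"
    if C: "C \<in> \<C>" for C
  proof (rule ccontr)
    assume ccon: "\<not> ?thesis"
    then have "C \<subseteq> \<Union>M" using sub[OF C] by auto
    moreover have "e \<subseteq> C" if "e \<in> M" "e \<inter> C \<noteq> {}" for e
      using sep[OF matching_inD(1,2)[OF M that(1)] C that(2)] that ccon by blast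
    ultimately show False using even_card_of_covered[OF M H] odd[OF C] by blast
  qed
  then obtain g where g: "\<And>C. C \<in> \<C> \<Longrightarrow> g C \<in> R \<union> (H - \<Union>M)"
      "\<And>C. C \<in> \<C> \<Longrightarrow> g C \<in> C \<or> g C \<in> R \<and> (\<exists>e\<in>M. g C \<in> e \<and> e \<inter> C \<noteq> {})"
    by metis
  have "inj_on g \<C>"
  proof (rule inj_onI)
    fix C D assume CD: "C \<in> \<C>" "D \<in> \<C>" "g C = g D"
    have "C \<inter> D \<noteq> {}"
    proof (cases "g C \<in> R")
      case True
      then have "g C \<notin> C" "g C \<notin> D" using sub CD by auto
      then obtain e f where e: "e \<in> M" "g C \<in> e" "e \<inter> C \<noteq> {}"
        and f: "f \<in> M" "g C \<in> f" "f \<inter> D \<noteq> {}"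
        using g(2)[OF CD(1)] g(2)[OF CD(2)] CD(3) by auto
      have "f = e" using matching_inD(3)[OF M f(1) e(1) f(2) e(2)] .
      obtain v where "e = {g C, v}"
        using edge_obtain[OF matching_inD(1)[OF M e(1)] e(2)] by blast
      then show ?thesis using e f \<open>f = e\<close> \<open>g C \<notin> C\<close> \<open>g C \<notin> D\<close> by auto
    next
      case False
      then show ?thesis using g(2)[OF CD(1)] g(2)[OF CD(2)] CD(3) by auto
    qed
    then show "C = D" using dis CD unfolding pairwise_def disjnt_def by blast
  qed
  then have "card \<C> \<le> card (R \<union> (H - \<Union>M))"
    using g(1) H R by (intro card_inj_on_le[of g]) (auto dest: finite_subset)
  also have "\<dots> \<le> card R + card (H - \<Union>M)" by (rule card_Un_le)
  finally show ?thesis .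
qed

text \<open>Keeping only the edges of \<open>N\<close> inside \<open>V - U\<close> newly uncovers
  just the partners of vertices of \<open>U - S\<close>, at most one for each.\<close>

lemma restrict_matching:
  assumes N: "matching_in (V - S) N" and V: "finite V" and SU: "S \<subseteq> U" "U \<subseteq> V"
  obtains L where "L \<subseteq> N" "matching_in (V - U) L"
    "card ((V - U) - \<Union>L) \<le> card (V - S - \<Union>N) + card (U - S)"
proof -
  define L where "L = {e \<in> N. e \<subseteq> V - U}"
  have mL: "matching_in (V - U) L"
    using N by (rule matching_in_mono) (auto simp: L_def)
  let ?P = "\<lambda>w u. u \<in> U - S \<and> (\<exists>e\<in>N. w \<in> e \<and> u \<in> e)"
  let ?D = "{w \<in> V - U. \<exists>u. ?P w u}"
  have "\<forall>w\<in>?D. \<exists>u. ?P w u" by blast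
  from bchoice[OF this] obtain g where "\<forall>w\<in>?D. ?P w (g w)" ..
  then have g: "?P w (g w)" if "w \<in> ?D" for w using that by blast
  have "inj_on g ?D"
  proof (rule inj_onI)
    fix v w assume vw: "v \<in> ?D" "w \<in> ?D" "g v = g w"
    obtain e f where e: "e \<in> N" "v \<in> e" "g v \<in> e" and f: "f \<in> N" "w \<in> f" "g v \<in> f"
      using g[OF vw(1)] g[OF vw(2)] vw(3) by auto
    have "f = e" using matching_inD(3)[OF N f(1) e(1) f(3) e(3)] .
    obtain z where "e = {g v, z}"
      using edge_obtain[OF matching_inD(1)[OF N e(1)] e(3)] by blast
    moreover have "g v \<in> U" using g[OF vw(1)] by blast
    ultimately show "v = w" using e f \<open>f = e\<close> vw by auto
  qed
  moreover have "g ` ?D \<subseteq> U - S" using g by blast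
  moreover have "finite (U - S)" using V SU by (meson finite_Diff finite_subset)
  ultimately have "card ?D \<le> card (U - S)" by (rule card_inj_on_le)
  moreover have "(V - U) - \<Union>L \<subseteq> (V - S - \<Union>N) \<union> ?D"
  proof
    fix w assume w: "w \<in> (V - U) - \<Union>L"
    show "w \<in> (V - S - \<Union>N) \<union> ?D"
    proof (cases "w \<in> \<Union>N")
      case True
      then obtain e where e: "e \<in> N" "w \<in> e" by blast
      then have "\<not> e \<subseteq> V - U" using w L_def by blast
      then show ?thesis using e w matching_inD(2)[OF N e(1)] by blast
    qed (use w SU in auto)
  qed
  then have "card ((V - U) - \<Union>L) \<le> card ((V - S - \<Union>N) \<union> ?D)"
    using V by (intro card_mono) auto
  then have "card ((V - U) - \<Union>L) \<le> card (V - S - \<Union>N) + card ?D"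
    using card_Un_le le_trans by blast
  ultimately show ?thesis using that[of L] mL L_def by auto
qed

end

section \<open>Gallai classes and stars at a critical barrier\<close>

text \<open>The graph \<open>F\<close> of the overview. The bound 2 on \<open>card N\<close> is what
  is left of \<open>k\<close> after \<open>k - 2\<close> edges are fixed and their ends
  deleted.\<close>

locale extendable = edge_system +
  fixes V :: "'a set" and n d :: nat
  assumes finV: "finite V"
    and parity: "even (card V + n + d)"
    and d_less_n: "d < n"
    and extend: "\<lbrakk>S \<subseteq> V; card S = n; matching_in (V - S) N; card N \<le> 2\<rbrakk> \<Longrightarrow>
      \<exists>N'. N \<subseteq> N' \<and> matching_in (V - S) N' \<and> card (V - S - \<Union>N') = d"

text \<open>\<open>missable\<close> is what the maximality of \<open>U\<close> provides; in
  Gallai--Edmonds terms, all components of the graph on \<open>V - U\<close> are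
  factor-critical.\<close>

locale critical_barrier = extendable +
  fixes U :: "'a set" and r :: nat
  assumes U_sub: "U \<subseteq> V"
    and card_U: "n + 2 \<le> card U"
    and r_eq: "r + n = card U + d"
    and missed_ge: "matching_in (V - U) M \<Longrightarrow> r \<le> card (V - U - \<Union>M)"
    and missable: "v \<in> V - U \<Longrightarrow>
      \<exists>M. matching_in (V - U) M \<and> card (V - U - \<Union>M) = r \<and> v \<notin> \<Union>M"
begin

abbreviation W where "W \<equiv> V - U"

definition opt :: "'a set set \<Rightarrow> bool" where
  "opt M \<longleftrightarrow> matching_in W M \<and> card (W - \<Union>M) = r"

text \<open>By Gallai's lemma the classes of this relation on \<open>W\<close> are the components of the graph
  induced on \<open>W\<close>; only the properties proved below are needed.\<close>

definition twin :: "'a \<Rightarrow> 'a \<Rightarrow> bool" where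
  "twin a b \<longleftrightarrow> (\<forall>M. opt M \<longrightarrow> a \<in> \<Union>M \<or> b \<in> \<Union>M \<or> a = b)"

definition cls :: "'a \<Rightarrow> 'a set" where
  "cls a = {b \<in> W. twin a b}"

lemma finW: "finite W" and finU: "finite U"
  using finV U_sub by (auto dest: finite_subset)

lemma twin_sym: "twin a b \<Longrightarrow> twin b a"
  unfolding twin_def by blast

text \<open>If an optimal matching missed both \<open>a\<close> and \<open>c\<close>, the exchange
  applied to one missing \<open>b\<close> would give an optimal matching that misses
  \<open>b\<close> together with \<open>a\<close> or \<open>c\<close>.\<close>

lemma twin_trans:
  assumes "a \<in> W" "b \<in> W" "c \<in> W" "twin a b" "twin b c"
  shows "twin a c"
proof (rule ccontr)
  assume "\<not> twin a c"
  then obtain M where M: "matching_in W M" "card (W - \<Union>M) = r" "a \<in> W - \<Union>M" "c \<in> W - \<Union>M" "a \<noteq> c"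
    using assms(1,3) unfolding twin_def opt_def by blast
  obtain N where N: "matching_in W N" "card (W - \<Union>N) = r" "b \<in> W - \<Union>N"
    using missable assms(2) by blast
  obtain L where L: "matching_in W L" "card (W - \<Union>L) = r" "b \<in> W - \<Union>L"
    "a \<in> W - \<Union>L \<or> c \<in> W - \<Union>L"
    using missed_pair_exchange[OF finW missed_ge M N, of thesis] that by simp
  then have "opt L" by (simp add: opt_def)
  moreover have "a \<noteq> b" "b \<noteq> c" using assms(4,5) \<open>\<not> twin a c\<close> by auto
  ultimately show False using L(3,4) assms(4,5) unfolding twin_def by blast
qed

lemma cls_self: "a \<in> W \<Longrightarrow> a \<in> cls a"
  by (simp add: cls_def twin_def)

lemma cls_sub: "cls a \<subseteq> W"
  by (auto simp: cls_def)

lemma cls_eq: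
  assumes "a \<in> W" "b \<in> cls a"
  shows "cls b = cls a"
proof -
  have b: "b \<in> W" "twin a b" using assms(2) by (auto simp: cls_def)
  show ?thesis
    using twin_trans[OF assms(1) b(1)] twin_trans[OF b(1) assms(1)] b(2) twin_sym[OF b(2)]
    unfolding cls_def by blast
qed

lemma disjoint_classes: "pairwise disjnt (cls ` W)"
proof (rule pairwiseI)
  fix C D assume CD: "C \<in> cls ` W" "D \<in> cls ` W" "C \<noteq> D"
  then obtain a b where "a \<in> W" "b \<in> W" "C = cls a" "D = cls b" by blast
  then show "disjnt C D" using CD(3) cls_eq[of a] cls_eq[of b] unfolding disjnt_def by blast
qed

text \<open>The ends of an edge in \<open>W\<close> are twins: a matching missing both could be
  enlarged by the edge, so it is not optimal.\<close>

lemma edge_sub_cls: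
  assumes e: "e \<in> E" "e \<subseteq> W" and v: "v \<in> e" "v \<in> cls a" "a \<in> W"
  shows "e \<subseteq> cls a"
proof -
  obtain w where w: "e = {v, w}" "w \<noteq> v" using edge_obtain[OF e(1) v(1)] by blast
  have "twin v w"
    unfolding twin_def
  proof (intro allI impI)
    fix M assume "opt M"
    then have M: "matching_in W M" "card (W - \<Union>M) = r" by (auto simp: opt_def)
    show "v \<in> \<Union>M \<or> w \<in> \<Union>M \<or> v = w"
    proof (rule ccontr)
      assume "\<not> ?thesis"
      then have miss: "e \<inter> \<Union>M = {}" using w by auto
      then have m: "matching_in W (insert e M)" using M e by (intro matching_in_insert)
      have "e \<notin> M" using miss v(1) by blast
      with finite_matching[OF M(1) finW] card_missed[OF m finW] card_missed[OF M(1) finW]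
        missed_ge[OF m] M(2) show False by simp
    qed
  qed
  then have "w \<in> cls v" using e w by (simp add: cls_def)
  then show ?thesis using cls_eq[OF v(3,2)] v(2) w(1) by simp
qed

text \<open>An optimal matching missing \<open>a\<close> covers all its other twins, and its edges
  do not leave the class.\<close>

lemma odd_cls:
  assumes "a \<in> W"
  shows "odd (card (cls a))"
proof -
  obtain M where M: "matching_in W M" "card (W - \<Union>M) = r" "a \<notin> \<Union>M"
    using missable[OF assms] by blast
  have "even (card (cls a - {a}))"
  proof (rule even_card_of_covered[OF M(1) finW])
    show "cls a - {a} \<subseteq> \<Union>M"
      using M unfolding cls_def twin_def opt_def by blast
    fix e assume e: "e \<in> M" "e \<inter> (cls a - {a}) \<noteq> {}"
    then obtain v where "v \<in> e" "v \<in> cls a" by blast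
    then have "e \<subseteq> cls a" using edge_sub_cls[OF matching_inD(1,2)[OF M(1) e(1)]] assms by blast
    then show "e \<subseteq> cls a - {a}" using M(3) e(1) by blast
  qed
  moreover have "finite (cls a)" using finW cls_sub by (rule rev_finite_subset)
  ultimately show ?thesis using cls_self[OF assms]
    by (metis card_Suc_Diff1 even_Suc)
qed

text \<open>An optimal matching misses exactly one vertex of each class: at most one because they
  are twins, at least one because the class is odd.\<close>

lemma card_classes: "card (cls ` W) = r"
proof -
  have "r \<noteq> 0" using r_eq card_U by linarith
  moreover have "r \<le> card W" using missed_ge[of "{}"] by (simp add: matching_in_def)
  ultimately have "W \<noteq> {}" by force
  then obtain M where M: "matching_in W M" "card (W - \<Union>M) = r" using missable by blast
  have "inj_on cls (W - \<Union>M)"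
  proof (rule inj_onI)
    fix a b assume ab: "a \<in> W - \<Union>M" "b \<in> W - \<Union>M" "cls a = cls b"
    then have "b \<in> cls a" using cls_self by blast
    then show "a = b" using ab M unfolding cls_def twin_def opt_def by blast
  qed
  moreover have "cls ` (W - \<Union>M) = cls ` W"
  proof (intro equalityI subsetI)
    fix C assume "C \<in> cls ` W"
    then obtain a where a: "a \<in> W" "C = cls a" by blast
    have "\<not> cls a \<subseteq> \<Union>M"
    proof
      assume "cls a \<subseteq> \<Union>M"
      moreover have "e \<subseteq> cls a" if "e \<in> M" "e \<inter> cls a \<noteq> {}" for e
        using edge_sub_cls[OF matching_inD(1,2)[OF M(1) that(1)]] that(2) a(1) by blast
      ultimately have "even (card (cls a))" by (rule even_card_of_covered[OF M(1) finW])
      then show False using odd_cls[OF a(1)] by blast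
    qed
    then obtain v where v: "v \<in> cls a" "v \<notin> \<Union>M" by blast
    then have "cls v = C" "v \<in> W" using cls_eq[OF a(1) v(1)] a(2) cls_sub by auto
    then show "C \<in> cls ` (W - \<Union>M)" using v by blast
  qed auto
  ultimately show ?thesis using card_image M(2) by metis
qed

text \<open>Extend \<open>{e}\<close> after deleting \<open>n\<close> vertices of
  \<open>U - e\<close>. Two vertices of \<open>U\<close> are then matched to each other, so the
  restriction to \<open>W\<close> misses at most \<open>r - 2\<close> vertices.\<close>

lemma U_independent:
  assumes e: "e \<in> E" "e \<subseteq> U"
  shows False
proof -
  have ce: "card e = 2" using card_edge[OF e(1)] .
  have "card (U - e) = card U - 2"
    using e(2) ce finite_edge[OF e(1)] by (simp add: card_Diff_subset)
  then have "n \<le> card (U - e)" using card_U by simp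
  then obtain S where S: "S \<subseteq> U - e" "card S = n" by (meson obtain_subset_with_card_n)
  have SV: "S \<subseteq> V" using S U_sub by blast
  have finS: "finite S" using SV finV by (rule finite_subset)
  have "matching_in (V - S) {e}" using e S U_sub unfolding matching_in_def by auto
  then obtain N where N: "e \<in> N" "matching_in (V - S) N" "card (V - S - \<Union>N) = d"
    using extend[OF SV S(2), of "{e}"] by auto
  \<comment> \<open>The ends of \<open>e\<close> are treated as deleted too, so that they do not
    count as possible partners of vertices of \<open>W\<close>.\<close>
  have "\<Union>(N - {e}) \<subseteq> V - (S \<union> e)"
    using matching_inD(2,3)[OF N(2)] N(1) by blast
  then have N': "matching_in (V - (S \<union> e)) (N - {e})"
    by (intro matching_in_mono[OF N(2)]) auto
  have "S \<union> e \<subseteq> U" using S e by blast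
  then obtain L where L: "matching_in W L"
    "card (W - \<Union>L) \<le> card (V - (S \<union> e) - \<Union>(N - {e})) + card (U - (S \<union> e))"
    using restrict_matching[OF N' finV _ U_sub] by blast
  have "V - (S \<union> e) - \<Union>(N - {e}) = V - S - \<Union>N" using N(1) by blast
  then have "card (V - (S \<union> e) - \<Union>(N - {e})) = d" using N(3) by simp
  moreover have "card (U - (S \<union> e)) = card U - (n + 2)"
  proof -
    have "card (S \<union> e) = n + 2"
      using S finS finite_edge[OF e(1)] ce by (subst card_Un_disjoint) auto
    then show ?thesis
      using \<open>S \<union> e \<subseteq> U\<close> finS finite_edge[OF e(1)] by (simp add: card_Diff_subset)
  qed
  ultimately show False using L(2) missed_ge[OF L(1)] r_eq card_U by linarith
qed

text \<open>Extend both edges after deleting \<open>n\<close> other vertices of \<open>U\<close>.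
  The restriction to \<open>W\<close> misses at most \<open>r\<close> vertices, so it is optimal;
  yet it misses both \<open>c\<close> and \<open>c'\<close>, whose partners lie in
  \<open>U\<close>.\<close>

lemma no_two_edges_to_twins:
  assumes u: "u \<in> U" "u' \<in> U" "u \<noteq> u'" and c: "c \<in> W" "c' \<in> W" "c \<noteq> c'" "twin c c'"
    and e: "{u, c} \<in> E" "{u', c'} \<in> E"
  shows False
proof -
  have "card (U - {u, u'}) = card U - 2"
    using u finU by (simp add: card_Diff_subset)
  then have "n \<le> card (U - {u, u'})" using card_U by simp
  then obtain S where S: "S \<subseteq> U - {u, u'}" "card S = n" by (meson obtain_subset_with_card_n)
  have SV: "S \<subseteq> V" and SU: "S \<subseteq> U" using S U_sub by auto
  have "u \<noteq> c'" "u' \<noteq> c" using u c by auto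
  then have "disjnt {u, c} {u', c'}" using u(3) c(3) by (simp add: disjnt_def)
  then have "pairwise disjnt {{u, c}, {u', c'}}"
    by (auto simp: pairwise_insert disjnt_def)
  moreover have "\<Union>{{u, c}, {u', c'}} \<subseteq> V - S" using S U_sub u c by auto
  ultimately have "matching_in (V - S) {{u, c}, {u', c'}}"
    using e by (simp add: matching_in_def)
  moreover have "card {{u, c}, {u', c'}} \<le> 2" by (simp add: card_insert_if)
  ultimately obtain N where N: "{u, c} \<in> N" "{u', c'} \<in> N" "matching_in (V - S) N"
    "card (V - S - \<Union>N) = d"
    using extend[OF SV S(2)] by (meson insert_subset)
  obtain L where L: "L \<subseteq> N" "matching_in W L"
    "card (W - \<Union>L) \<le> card (V - S - \<Union>N) + card (U - S)"
    using restrict_matching[OF N(3) finV SU U_sub] by blast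
  have "card (U - S) = card U - n"
    using S(2) card_Diff_subset[OF finite_subset[OF SU finU] SU] by simp
  then have "card (W - \<Union>L) \<le> r" using L(3) N(4) r_eq card_U by linarith
  then have "opt L" using L(2) missed_ge[OF L(2)] by (simp add: opt_def)
  moreover have "c \<notin> \<Union>L"
  proof
    assume "c \<in> \<Union>L"
    then obtain f where f: "f \<in> L" "c \<in> f" by blast
    then have "f = {u, c}" using matching_inD(3)[OF N(3), of f "{u, c}" c] N(1) L(1) by auto
    then show False using matching_inD(2)[OF L(2) f(1)] u by auto
  qed
  moreover have "c' \<notin> \<Union>L"
  proof
    assume "c' \<in> \<Union>L"
    then obtain f where f: "f \<in> L" "c' \<in> f" by blast
    then have "f = {u', c'}" using matching_inD(3)[OF N(3), of f "{u', c'}" c'] N(2) L(1) by auto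
    then show False using matching_inD(2)[OF L(2) f(1)] u by auto
  qed
  ultimately show False using c(3,4) by (auto simp: twin_def)
qed

text \<open>Any two edges between \<open>U\<close> and a class share an end, and in a bipartite
  graph this forces a star.\<close>

lemma star_centre:
  assumes a: "a \<in> W"
  shows "\<exists>z \<in> U \<union> cls a. \<forall>u\<in>U. \<forall>c\<in>cls a. {u, c} \<in> E \<longrightarrow> z \<in> {u, c}"
proof -
  have twins: "u = u' \<or> c = c'"
    if "u \<in> U" "u' \<in> U" "c \<in> cls a" "c' \<in> cls a" "{u, c} \<in> E" "{u', c'} \<in> E" for u u' c c'
  proof (rule ccontr)
    assume "\<not> (u = u' \<or> c = c')"
    moreover have "c \<in> W" "c' \<in> W" "twin c c'"
      using that(3,4) cls_sub cls_eq[OF a that(3)] by (auto simp: cls_def)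
    ultimately show False using no_two_edges_to_twins[of u u' c c'] that by blast
  qed
  show ?thesis
  proof (cases "\<exists>u\<in>U. \<exists>c\<in>cls a. {u, c} \<in> E")
    case False
    \<comment> \<open>Without edges any centre is correct; \<open>a\<close> is available in the
      class.\<close>
    then show ?thesis using cls_self[OF a] by blast
  next
    case True
    then obtain u0 c0 where e0: "u0 \<in> U" "c0 \<in> cls a" "{u0, c0} \<in> E" by blast
    show ?thesis
    proof (cases "\<forall>u\<in>U. \<forall>c\<in>cls a. {u, c} \<in> E \<longrightarrow> u = u0")
      case True
      then show ?thesis using e0(1) by blast
    next
      case False
      then obtain u1 c1 where e1: "u1 \<in> U" "c1 \<in> cls a" "{u1, c1} \<in> E" "u1 \<noteq> u0" by blast
      then have "c1 = c0" using twins e0 by blast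
      then have "c = c0" if "u \<in> U" "c \<in> cls a" "{u, c} \<in> E" for u c
        using twins[OF that(1) e0(1) that(2) e0(2) that(3) e0(3)]
          twins[OF that(1) e1(1) that(2) e1(2) that(3) e1(3)] e1(4) by auto
      then show ?thesis using e0(2) by blast
    qed
  qed
qed

text \<open>\<open>K\<close> collects the star centres and \<open>PB\<close> the classes centred in
  \<open>U\<close>. Once \<open>n\<close> vertices \<open>Z\<close> are deleted,
  \<open>K - Z\<close> separates the classes in \<open>PB\<close> and the single vertices of
  \<open>U - (K \<union> Z)\<close>, and \<open>barrier_bound\<close> limits their number.\<close>

lemma contradiction: False
proof -
  let ?P = "cls ` W"
  have "\<forall>C\<in>?P. \<exists>z \<in> U \<union> C. \<forall>u\<in>U. \<forall>c\<in>C. {u, c} \<in> E \<longrightarrow> z \<in> {u, c}"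
    using star_centre by simp
  then have "\<forall>C\<in>?P. \<exists>z. z \<in> U \<union> C \<and> (\<forall>u\<in>U. \<forall>c\<in>C. {u, c} \<in> E \<longrightarrow> z \<in> {u, c})"
    by (simp add: Bex_def)
  from bchoice[OF this] obtain z where
    z: "\<forall>C\<in>?P. z C \<in> U \<union> C \<and> (\<forall>u\<in>U. \<forall>c\<in>C. {u, c} \<in> E \<longrightarrow> z C \<in> {u, c})" ..
  have z_in: "z C \<in> U \<union> C" if "C \<in> ?P" for C using bspec[OF z that] by blast
  have z_edge: "z C = u \<or> z C = c" if "C \<in> ?P" "u \<in> U" "c \<in> C" "{u, c} \<in> E" for C u c
    using mp[OF bspec[OF bspec[OF conjunct2[OF bspec[OF z that(1)]] that(2)] that(3)] that(4)] by simp
  have class_sub: "C \<subseteq> W" if "C \<in> ?P" for C using that cls_sub by auto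
  define K where "K = z ` ?P"
  define PB where "PB = {C \<in> ?P. z C \<in> U}"
  have KV: "K \<subseteq> V"
  proof
    fix w assume "w \<in> K"
    then obtain C where C: "C \<in> ?P" "w = z C" unfolding K_def by blast
    show "w \<in> V" using z_in[OF C(1)] class_sub[OF C(1)] U_sub C(2) by blast
  qed
  have finP: "finite ?P" using finW by simp
  have finK: "finite K" using finP K_def by simp
  have finPB: "finite PB" "PB \<subseteq> ?P" using finP PB_def by auto
  have card_KU: "card (K \<inter> U) \<le> card PB"
  proof -
    have "K \<inter> U = z ` PB" unfolding K_def PB_def by auto
    then show ?thesis using card_image_le[OF finPB(1)] by simp
  qed
  have card_K: "card K = card (K \<inter> U) + (r - card PB)" "card PB \<le> r"
  proof -
    \<comment> \<open>A class outside \<open>PB\<close> contains its own centre, and classes are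
      disjoint.\<close>
    have "inj_on z (?P - PB)"
    proof (rule inj_onI)
      fix C D assume CD: "C \<in> ?P - PB" "D \<in> ?P - PB" "z C = z D"
      then have "z C \<in> C" "z C \<in> D" using z_in[of C] z_in[of D] unfolding PB_def by auto
      then have "\<not> disjnt C D" by (auto simp: disjnt_def)
      then show "C = D" using pairwiseD[OF disjoint_classes, of C D] CD by blast
    qed
    then have "card (z ` (?P - PB)) = r - card PB"
      using finPB card_classes by (simp add: card_image card_Diff_subset)
    moreover have "z ` (?P - PB) = K - U" unfolding K_def PB_def by auto
    moreover have "card K = card (K \<inter> U) + card (K - U)"
      using finK by (rule card_Int_Diff)
    ultimately show "card K = card (K \<inter> U) + (r - card PB)" by simp
    show "card PB \<le> r" using card_mono[OF finP finPB(2)] card_classes by simp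
  qed
  have bound: "card PB + card (U - (K \<union> Z)) \<le> card (K - Z) + d"
    if Z: "Z \<subseteq> K \<union> U" "card Z = n" for Z
  proof -
    let ?S = "(\<lambda>u. {u}) ` (U - (K \<union> Z))"
    have ZV: "Z \<subseteq> V" using Z(1) KV U_sub by blast
    obtain N where N: "matching_in (V - Z) N" "card (V - Z - \<Union>N) = d"
      using extend[OF ZV Z(2), of "{}"] by (auto simp: matching_in_def)
    \<comment> \<open>A centre in \<open>W\<close> lies in the class it belongs to, and the centre
      of a class in \<open>PB\<close> is in \<open>U\<close>; hence such a class contains no
      centre.\<close>
    have PBW: "C \<subseteq> W - (K \<union> Z)" if C: "C \<in> PB" for C
    proof
      fix c assume c: "c \<in> C"
      have C': "C \<in> ?P" "z C \<in> U" using C PB_def by auto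
      have cW: "c \<in> W" using c class_sub C' by blast
      have "c \<notin> K"
      proof
        assume "c \<in> K"
        then obtain D where D: "D \<in> ?P" "c = z D" unfolding K_def by blast
        then have "c \<in> D" using z_in[of D] cW by auto
        then have "\<not> disjnt C D" using c by (auto simp: disjnt_def)
        then have "C = D" using pairwiseD[OF disjoint_classes C'(1) D(1)] by blast
        then show False using C'(2) D(2) cW by blast
      qed
      then show "c \<in> W - (K \<union> Z)" using cW Z(1) by blast
    qed
    have "card (PB \<union> ?S) \<le> card (K - Z) + card (V - Z - \<Union>N)"
    proof (rule barrier_bound[OF N(1)])
      show "finite (V - Z)" using finV by simp
      show "K - Z \<subseteq> V - Z" using KV by blast
      show "C \<subseteq> V - Z - (K - Z)" if "C \<in> PB \<union> ?S" for C
        using that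
      proof
        assume "C \<in> PB"
        then show ?thesis using PBW[of C] by blast
      next
        assume "C \<in> ?S"
        then show ?thesis using U_sub by auto
      qed
      show "odd (card C)" if "C \<in> PB \<union> ?S" for C
        using that
      proof
        assume "C \<in> PB"
        then show ?thesis using finPB(2) odd_cls by blast
      qed auto
      show "pairwise disjnt (PB \<union> ?S)"
      proof (rule pairwiseI)
        fix C D assume CD: "C \<in> PB \<union> ?S" "D \<in> PB \<union> ?S" "C \<noteq> D"
        have mixed: "disjnt C' D'" "disjnt D' C'" if "C' \<in> PB" "D' \<in> ?S" for C' D'
          using PBW[OF that(1)] that(2) by (auto simp: disjnt_def)
        have "disjnt C D" if "C \<in> PB" "D \<in> PB"
          using pairwiseD[OF disjoint_classes, of C D] that finPB(2) CD(3) by auto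
        moreover have "disjnt C D" if "C \<in> ?S" "D \<in> ?S"
          using that CD(3) by (auto simp: disjnt_def)
        ultimately show "disjnt C D" using CD(1,2) mixed by (meson UnE)
      qed
      fix e C assume e: "e \<in> E" "e \<subseteq> V - Z" and C: "C \<in> PB \<union> ?S" and meet: "e \<inter> C \<noteq> {}"
      obtain v where v: "v \<in> e" "v \<in> C" using meet by blast
      obtain w where w: "e = {v, w}" using edge_obtain[OF e(1) v(1)] by blast
      \<comment> \<open>An edge leaving a class in \<open>PB\<close> ends in \<open>U\<close>, hence
        at the centre. An edge at a vertex of \<open>U - K\<close> goes to \<open>W\<close> by
        independence, and its end there must be the centre of its class.\<close>
      show "e \<subseteq> C \<or> e \<inter> (K - Z) \<noteq> {}"
      proof (cases "C \<in> PB")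
        case True
        then obtain a where a: "a \<in> W" "C = cls a" and zC: "z C \<in> U" unfolding PB_def by blast
        have vW: "v \<in> W" using v(2) PBW[OF True] by blast
        show ?thesis
        proof (cases "w \<in> U")
          case True
          then have "z C = w \<or> z C = v"
            using z_edge[of C w v] a v(2) e(1) w by (simp add: insert_commute)
          moreover have "z C \<in> K" using a by (simp add: K_def)
          ultimately have "w \<in> K" using zC vW by auto
          then show ?thesis using w e(2) by blast
        next
          case False
          then have "e \<subseteq> W" using e(2) w vW by blast
          then show ?thesis using edge_sub_cls[OF e(1) _ v(1)] v(2) a by blast
        qed
      next
        case False
        then have vU: "v \<in> U" "v \<notin> K" using C v(2) by auto
        then have wW: "w \<in> W" using U_independent[OF e(1)] e(2) w by blast
        then have "z (cls w) = v \<or> z (cls w) = w"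
          using z_edge[of "cls w" v w] cls_self[OF wW] vU(1) e(1) w wW by simp
        moreover have "z (cls w) \<in> K" using wW by (simp add: K_def)
        ultimately have "w \<in> K" using vU(2) by auto
        then show ?thesis using w e(2) by blast
      qed
    qed
    moreover have "PB \<inter> ?S = {}" using PBW by blast
    then have "card (PB \<union> ?S) = card PB + card ?S"
      using finPB finU by (intro card_Un_disjoint) auto
    moreover have "card ?S = card (U - (K \<union> Z))" by (intro card_image) simp
    ultimately show ?thesis using N(2) by simp
  qed
  have UK: "card (U - K) + card (K \<inter> U) = card U"
    using card_Int_Diff[OF finU, of K] by (simp add: Int_commute)
  show False
  proof (cases "n \<le> card K")
    case True
    then obtain Z where Z: "Z \<subseteq> K" "card Z = n" by (meson obtain_subset_with_card_n)
    then have "U - (K \<union> Z) = U - K" by blast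
    moreover have "card (K - Z) + n = card K"
      using Z finK True by (simp add: card_Diff_subset finite_subset)
    moreover have "card PB + card (U - (K \<union> Z)) \<le> card (K - Z) + d"
      using bound[of Z] Z by blast
    ultimately show False
      using UK card_K card_KU r_eq d_less_n by simp
  next
    case False
    \<comment> \<open>All centres are deleted and \<open>Z\<close> is filled up from
      \<open>U - K\<close>. There is room, since
      \<open>card K + card (U - K) = card U + (r - card PB)\<close>.\<close>
    then have "n - card K \<le> card (U - K)" using UK card_U card_K by linarith
    then obtain Y where Y: "Y \<subseteq> U - K" "card Y = n - card K"
      by (meson obtain_subset_with_card_n)
    have finY: "finite Y" using Y(1) finU by (meson finite_Diff finite_subset)
    have "card (K \<union> Y) = n"
      using Y finK finY False by (subst card_Un_disjoint) auto
    moreover have "K \<union> Y \<subseteq> K \<union> U" using Y by blast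
    ultimately have "card PB + card (U - (K \<union> (K \<union> Y))) \<le> card (K - (K \<union> Y)) + d"
      using bound by blast
    moreover have "U - (K \<union> (K \<union> Y)) = (U - K) - Y" "K - (K \<union> Y) = {}" by blast+
    ultimately have "card PB + card ((U - K) - Y) \<le> d" by (simp only: card.empty add_0)
    moreover have "card ((U - K) - Y) = card (U - K) - (n - card K)"
      using Y finY by (simp add: card_Diff_subset)
    ultimately have "card PB + (card (U - K) - (n - card K)) \<le> d" by simp
    \<comment> \<open>The bound amounts to \<open>card U + r \<le> n + d\<close>, whereas
      \<open>card U \<ge> n + 2\<close> and \<open>r \<ge> d + 2\<close>.\<close>
    then show False using UK card_K card_U r_eq False by linarith
  qed
qed

end

section \<open>The defect after deleting \<open>n + 2\<close> vertices\<close>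

context extendable begin

text \<open>If \<open>X\<close> violated the bound, a largest violating set, which need not contain
  \<open>X\<close>, would be a critical barrier.\<close>

lemma small_defect_after_deletion:
  assumes X: "X \<subseteq> V" "card X = n + 2"
  obtains M where "matching_in (V - X) M" "card (V - X - \<Union>M) \<le> d"
    "even (d - card (V - X - \<Union>M))"
proof -
  define bad where "bad U \<longleftrightarrow> U \<subseteq> V \<and> n + 2 \<le> card U \<and>
    (\<forall>M. matching_in (V - U) M \<longrightarrow> card U + d \<le> card (V - U - \<Union>M) + n)" for U
  have par: "even (card (V - U - \<Union>M) + card U + n + d)"
    if "U \<subseteq> V" "matching_in (V - U) M" for U M
  proof -
    have "card (V - U - \<Union>M) + 2 * card M = card (V - U)"
      using card_missed[OF that(2)] finV by simp
    moreover have "card (V - U) + card U = card V"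
      using that(1) finV by (metis card_Diff_subset card_mono finite_subset le_add_diff_inverse2)
    ultimately have "card (V - U - \<Union>M) + card U + 2 * card M = card V" by simp
    then show ?thesis using parity by (metis dvd_triv_left even_add)
  qed
  have "\<not> bad X"
  proof
    assume "bad X"
    then have "\<exists>U. bad U \<and> (\<forall>U'. bad U' \<longrightarrow> card U' \<le> card U)"
    proof (rule ex_has_greatest_nat)
      show "\<forall>U. bad U \<longrightarrow> card U < Suc (card V)"
        using finV by (simp add: bad_def card_mono less_Suc_eq_le)
    qed
    then obtain U where U: "bad U" and Umax: "\<And>U'. bad U' \<Longrightarrow> card U' \<le> card U" by blast
    have UV: "U \<subseteq> V" and cU: "n + 2 \<le> card U" using U bad_def by auto
    have finU: "finite U" using UV finV by (rule finite_subset)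
    define r where "r = card U + d - n"
    have r: "r + n = card U + d" using cU r_def by simp
    have ge: "r \<le> card (V - U - \<Union>M)" if "matching_in (V - U) M" for M
      using U that r unfolding bad_def by force
    have "critical_barrier E V n d U r"
    proof unfold_locales
      fix v assume v: "v \<in> V - U"
      \<comment> \<open>Maximality gives a matching avoiding \<open>v\<close> that misses at most
        \<open>r\<close> vertices besides \<open>v\<close>. Parity excludes exactly
        \<open>r\<close>, so counting \<open>v\<close> as well it misses at most
        \<open>r\<close>.\<close>
      have "\<not> bad (insert v U)" using Umax[of "insert v U"] v finU by auto
      then obtain M where M: "matching_in (V - insert v U) M"
        "card (V - insert v U - \<Union>M) + n < card (insert v U) + d"
        using v UV cU finU unfolding bad_def by (auto simp: not_le)
      have ci: "card (insert v U) = Suc (card U)" using v finU by simp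
      have "even (card (V - insert v U - \<Union>M) + card (insert v U) + n + d)"
        using par[OF _ M(1)] v UV by blast
      then have ev: "even (card (V - insert v U - \<Union>M) + Suc (card U) + n + d)"
        by (simp only: ci)
      have lt: "card (V - insert v U - \<Union>M) \<le> r"
        using M(2) v finU r by simp
      have "card (V - insert v U - \<Union>M) \<noteq> r"
      proof
        assume eq: "card (V - insert v U - \<Union>M) = r"
        have "card (V - insert v U - \<Union>M) + Suc (card U) + n + d = Suc (2 * (card U + d))"
          using r eq by simp
        with ev show False by (simp only: even_Suc dvd_triv_left) simp
      qed
      with lt have lt: "card (V - insert v U - \<Union>M) < r" by simp
      have m: "matching_in (V - U) M" using M(1) unfolding matching_in_def by blast
      have vM: "v \<notin> \<Union>M" using M(1) unfolding matching_in_def by blast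
      have "V - U - \<Union>M = insert v (V - insert v U - \<Union>M)" using v vM by blast
      then have "card (V - U - \<Union>M) = Suc (card (V - insert v U - \<Union>M))"
        using finV by simp
      then show "\<exists>M. matching_in (V - U) M \<and> card (V - U - \<Union>M) = r \<and> v \<notin> \<Union>M"
        using ge[OF m] lt m vM by (intro exI[of _ M]) simp
    qed (use UV cU r ge in auto)
    then show False by (rule critical_barrier.contradiction)
  qed
  \<comment> \<open>Only defect \<open>d + 1\<close> remains to be excluded, again by
    parity.\<close>
  then obtain M where M: "matching_in (V - X) M" "card (V - X - \<Union>M) < d + 2"
    using X unfolding bad_def by (auto simp: not_le)
  have "card (V - X - \<Union>M) + card X + n + d = card (V - X - \<Union>M) + d + 2 * (n + 1)"
    using X(2) by simp
  with par[OF X(1) M(1)] have "even (card (V - X - \<Union>M) + d + 2 * (n + 1))" by (simp only:)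
  then have "even (card (V - X - \<Union>M) + d)" by simp
  moreover from this have "card (V - X - \<Union>M) \<noteq> Suc d" by (metis even_Suc even_add)
  ultimately show ?thesis using that[OF M(1)] M(2) by simp
qed

end

section \<open>Translation to graphs and monotonicity in \<open>k\<close>\<close>

lemma edge_system_edges: "simple_graph G \<Longrightarrow> edge_system (edges G)"
  by unfold_locales (simp add: simple_graph_def)

lemma matching_delete_verts_iff:
  assumes "simple_graph G"
  shows "matching (delete_verts G S) M \<longleftrightarrow> edge_system.matching_in (edges G) (verts G - S) M"
proof -
  interpret edge_system "edges G" using assms by (rule edge_system_edges)
  have "M \<subseteq> {e \<in> edges G. e \<inter> S = {}} \<longleftrightarrow> M \<subseteq> edges G \<and> \<Union>M \<subseteq> verts G - S"
    using assms unfolding simple_graph_def by blast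
  then show ?thesis unfolding matching_def matching_in_def delete_verts_def by auto
qed

lemma nkd_graph_iff:
  assumes G: "simple_graph G"
  shows "nkd_graph n k d G \<longleftrightarrow>
    n + 2 * k + d + 2 \<le> card (verts G) \<and> even (card (verts G) + n + d) \<and>
    (\<forall>S. S \<subseteq> verts G \<and> card S = n \<longrightarrow>
      (\<exists>M. edge_system.matching_in (edges G) (verts G - S) M \<and> card M = k) \<and>
      (\<forall>M. edge_system.matching_in (edges G) (verts G - S) M \<and> card M = k \<longrightarrow>
        (\<exists>M'. M \<subseteq> M' \<and> edge_system.matching_in (edges G) (verts G - S) M' \<and>
          card (verts G - S - \<Union>M') = d)))"
proof -
  interpret edge_system "edges G" using G by (rule edge_system_edges)
  have fin: "finite (verts G)" using G by (simp add: simple_graph_def)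
  have defect: "defect_matching d (delete_verts G S) M \<longleftrightarrow>
      matching_in (verts G - S) M \<and> card (verts G - S - \<Union>M) = d" for S M
  proof -
    have "card (\<Union>M) + d = card (verts G - S) \<longleftrightarrow> card (verts G - S - \<Union>M) = d"
      if "matching_in (verts G - S) M"
      using card_missed[OF that] card_Union_matching[OF that] fin by auto
    then show ?thesis
      unfolding defect_matching_def matching_delete_verts_iff[OF G]
      by (auto simp: delete_verts_def)
  qed
  have "even (card (verts G) - n - d) \<longleftrightarrow> even (card (verts G) + n + d)"
    if "n + 2 * k + d + 2 \<le> card (verts G)"
    using that by presburger
  then show ?thesis
    unfolding nkd_graph_def k_matching_def defect matching_delete_verts_iff[OF G]
    using G by (auto simp: conj_commute)
qed

text \<open>Replace \<open>M\<close> by a matching \<open>L\<close> with one more edge that still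
  covers \<open>\<Union>M\<close>, and extend \<open>L\<close> to defect \<open>d\<close>. An edge
  added to \<open>L\<close> in doing so avoids \<open>\<Union>M\<close>, so together with
  \<open>M\<close> it forms a matching to which the hypothesis applies.\<close>

lemma nkd_graph_decrease:
  assumes "nkd_graph n (Suc k) d G"
  shows "nkd_graph n k d G"
proof -
  have G: "simple_graph G" using assms by (simp add: nkd_graph_def)
  interpret edge_system "edges G" using G by (rule edge_system_edges)
  let ?V = "verts G"
  have finV: "finite ?V" using G by (simp add: simple_graph_def)
  have size: "n + 2 * Suc k + d + 2 \<le> card ?V" and par: "even (card ?V + n + d)"
    and ex: "\<And>S. \<lbrakk>S \<subseteq> ?V; card S = n\<rbrakk> \<Longrightarrow> \<exists>M. matching_in (?V - S) M \<and> card M = Suc k"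
    and ext: "\<And>S M. \<lbrakk>S \<subseteq> ?V; card S = n; matching_in (?V - S) M; card M = Suc k\<rbrakk> \<Longrightarrow>
      \<exists>M'. M \<subseteq> M' \<and> matching_in (?V - S) M' \<and> card (?V - S - \<Union>M') = d"
    using assms unfolding nkd_graph_iff[OF G] by blast+
  have "\<exists>M. matching_in (?V - S) M \<and> card M = k" if S: "S \<subseteq> ?V" "card S = n" for S
  proof -
    obtain M where M: "matching_in (?V - S) M" "card M = Suc k" using ex[OF S] by blast
    then obtain M' where "M' \<subseteq> M" "card M' = k"
      by (metis obtain_subset_with_card_n le_SucI order_refl)
    then show ?thesis using matching_in_subset[OF M(1)] by blast
  qed
  moreover have "\<exists>M'. M \<subseteq> M' \<and> matching_in (?V - S) M' \<and> card (?V - S - \<Union>M') = d"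
    if S: "S \<subseteq> ?V" "card S = n" and M: "matching_in (?V - S) M" "card M = k" for S M
  proof -
    have finS: "finite (?V - S)" using finV by simp
    obtain N where N: "matching_in (?V - S) N" "card N = Suc k" using ex[OF S] by blast
    have "card M < card N" using M(2) N(2) by simp
    then obtain L where L: "matching_in (?V - S) L" "card L = Suc (card M)" "\<Union>M \<subseteq> \<Union>L"
      using matching_cover_extend[OF M(1) N(1) finS] by blast
    obtain L' where L': "L \<subseteq> L'" "matching_in (?V - S) L'" "card (?V - S - \<Union>L') = d"
      using ext[OF S L(1)] L(2) M(2) by auto
    have "card (?V - S) = card ?V - n"
      using S finV by (metis card_Diff_subset finite_subset)
    \<comment> \<open>The size bound leaves room for at least \<open>k + 2\<close> edges in a
      defect-\<open>d\<close> matching, while \<open>L\<close> has \<open>k + 1\<close>.\<close>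
    then have "card L < card L'"
      using card_missed[OF L'(2) finS] L'(3) L(2) M(2) size by simp
    then have "\<not> L' \<subseteq> L"
      using L'(1) by auto
    then obtain f where f: "f \<in> L'" "f \<notin> L" by blast
    have "f \<inter> \<Union>L = {}" using matching_inD(3)[OF L'(2)] f L'(1) by blast
    then have miss: "f \<inter> \<Union>M = {}" using L(3) by blast
    have fE: "f \<in> edges G" "f \<subseteq> ?V - S" using matching_inD(1,2)[OF L'(2) f(1)] .
    have m: "matching_in (?V - S) (insert f M)"
      using M(1) fE miss by (rule matching_in_insert)
    have "f \<noteq> {}" using card_edge[OF fE(1)] by auto
    then have "f \<notin> M" using miss by blast
    then have "card (insert f M) = Suc k" using finite_matching[OF M(1) finS] M(2) by simp
    then show ?thesis using ext[OF S m] by blast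
  qed
  moreover have "n + 2 * k + d + 2 \<le> card ?V" using size by simp
  ultimately show ?thesis unfolding nkd_graph_iff[OF G] using par by blast
qed

lemma nkd_graph_antimono:
  assumes "j \<le> k" "nkd_graph n k d G"
  shows "nkd_graph n j d G"
  using assms by (induction rule: dec_induct) (auto dest: nkd_graph_decrease)

section \<open>Adding an edge between non-adjacent vertices\<close>

theorem theorem2p1:
  fixes G :: "'a ugraph" and n k d :: nat and x y :: 'a
  assumes "n > d" and "k \<ge> 1"
    and "nkd_graph n k d G"
    and "x \<in> verts G" and "y \<in> verts G" and "x \<noteq> y"
    and "{x, y} \<notin> edges G"
  shows "nkd_graph n (k - 1) d (add_edge G x y)"
proof -
  let ?V = "verts G" and ?G' = "add_edge G x y"
  have G: "simple_graph G" using assms(3) by (simp add: nkd_graph_def)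
  have G': "simple_graph ?G'"
    using G assms(4-6) by (simp add: simple_graph_def add_edge_def)
  interpret g: edge_system "edges G" using G by (rule edge_system_edges)
  interpret h: edge_system "edges ?G'" using G' by (rule edge_system_edges)
  have V': "verts ?G' = ?V" and E': "edges ?G' = insert {x, y} (edges G)"
    by (simp_all add: add_edge_def)
  have finV: "finite ?V" using G by (simp add: simple_graph_def)
  have lift: "h.matching_in W M" if "g.matching_in W M" for W M
    using that unfolding g.matching_in_def h.matching_in_def by (auto simp: E')
  have lower: "g.matching_in W M" if "h.matching_in W M" "{x, y} \<notin> M" for W M
    using that unfolding g.matching_in_def h.matching_in_def by (auto simp: E')
  have size: "n + 2 * k + d + 2 \<le> card ?V" and par: "even (card ?V + n + d)"
    using assms(3) unfolding nkd_graph_iff[OF G] by blast+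
  have ext: "\<exists>M'. M \<subseteq> M' \<and> g.matching_in (?V - S) M' \<and> card (?V - S - \<Union>M') = d"
    if "S \<subseteq> ?V" "card S = n" "g.matching_in (?V - S) M" "card M \<le> k" for S M
    using nkd_graph_antimono[OF that(4) assms(3)] that(1-3) unfolding nkd_graph_iff[OF G] by blast
  have "\<exists>M. h.matching_in (?V - S) M \<and> card M = k - 1" if "S \<subseteq> ?V" "card S = n" for S
  proof -
    have "nkd_graph n (k - 1) d G" using nkd_graph_antimono[OF _ assms(3)] by simp
    then have "\<exists>M. g.matching_in (?V - S) M \<and> card M = k - 1"
      using that unfolding nkd_graph_iff[OF G] by simp
    then show ?thesis using lift by blast
  qed
  moreover have "\<exists>M'. M \<subseteq> M' \<and> h.matching_in (?V - S) M' \<and> card (?V - S - \<Union>M') = d"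
    if S: "S \<subseteq> ?V" "card S = n" and M: "h.matching_in (?V - S) M" "card M = k - 1" for S M
  proof (cases "{x, y} \<in> M")
    case False
    have "card M \<le> k" using M(2) by simp
    from ext[OF S lower[OF M(1) False] this] show ?thesis using lift by blast
  next
    case True
    have finM: "finite M" using h.finite_matching[OF M(1)] finV by simp
    define M0 where "M0 = M - {{x, y}}"
    have M0: "g.matching_in (?V - S) M0"
      using h.matching_in_subset[OF M(1), of M0] lower unfolding M0_def by blast
    have "card M \<noteq> 0" using True finM by auto
    then have card_M0: "card M0 + 2 = k" using True finM M(2) unfolding M0_def by simp
    have xy: "x \<notin> S" "y \<notin> S" using h.matching_inD(2)[OF M(1) True] by auto
    have miss: "{x, y} \<inter> \<Union>M0 = {}"
      using h.matching_inD(3)[OF M(1) True] unfolding M0_def by blast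
    define V0 where "V0 = ?V - \<Union>M0"
    have M0V: "g.matching_in ?V M0" using M0 unfolding g.matching_in_def by blast
    have card_V0: "card V0 + 2 * card M0 = card ?V"
      unfolding V0_def using g.card_missed[OF M0V finV] .
    \<comment> \<open>A matching of at most two edges in \<open>V0 - T\<close> joins with
      \<open>M0\<close> to at most \<open>k\<close> edges; extend the union in \<open>G\<close> and
      then remove \<open>M0\<close> again.\<close>
    interpret f: extendable "edges G" V0 n d
    proof unfold_locales
      show "finite V0" using finV V0_def by simp
      have "card ?V + n + d = (card V0 + n + d) + 2 * card M0" using card_V0 by simp
      with par show "even (card V0 + n + d)" by simp
      show "d < n" by (rule assms(1))
      fix T N
      assume T: "T \<subseteq> V0" "card T = n" and N: "g.matching_in (V0 - T) N" "card N \<le> 2"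
      have TV: "T \<subseteq> ?V" using T V0_def by blast
      have sub: "g.matching_in (?V - T) M0"
        using M0V T(1) unfolding g.matching_in_def V0_def by blast
      have eq: "V0 - T = ?V - T - \<Union>M0" unfolding V0_def by blast
      have m: "g.matching_in (?V - T) (M0 \<union> N)"
        using g.matching_in_Un[OF sub] N(1) eq by simp
      have "card (M0 \<union> N) \<le> k"
        using card_Un_le[of M0 N] N(2) card_M0 by linarith
      from ext[OF TV T(2) m this] obtain M' where
        M': "M0 \<union> N \<subseteq> M'" "g.matching_in (?V - T) M'" "card (?V - T - \<Union>M') = d" by blast
      have "N \<subseteq> M' - M0"
        using M'(1) g.disjoint_matchings[of "?V - T" M0 N] N(1) eq by auto
      moreover have "g.matching_in (V0 - T) (M' - M0)"
      proof (rule g.matching_in_mono[OF M'(2)])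
        have "\<Union>(M' - M0) \<inter> \<Union>M0 = {}"
          using g.matching_inD(3)[OF M'(2)] M'(1) by blast
        moreover have "\<Union>(M' - M0) \<subseteq> ?V - T"
          using M'(2) unfolding g.matching_in_def by blast
        ultimately show "\<Union>(M' - M0) \<subseteq> V0 - T" unfolding eq by blast
      qed simp
      moreover have "V0 - T - \<Union>(M' - M0) = ?V - T - \<Union>M'"
        unfolding eq using M'(1) by blast
      ultimately show "\<exists>N'. N \<subseteq> N' \<and> g.matching_in (V0 - T) N' \<and> card (V0 - T - \<Union>N') = d"
        using M'(3) by (intro exI[of _ "M' - M0"]) simp
    qed
    define X where "X = S \<union> {x, y}"
    have XV: "X \<subseteq> V0"
      using S(1) assms(4,5) miss M0 unfolding X_def V0_def g.matching_in_def by blast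
    have finS: "finite S" using S(1) finV by (rule finite_subset)
    have card_X: "card X = n + 2"
      using xy assms(6) finS S(2) unfolding X_def by simp
    obtain L where L: "g.matching_in (V0 - X) L" "card (V0 - X - \<Union>L) \<le> d"
      "even (d - card (V0 - X - \<Union>L))"
      using f.small_defect_after_deletion[OF XV card_X] by blast
    have finVX: "finite (V0 - X)" using finV V0_def by simp
    have "card (V0 - X) + (n + 2) = card V0"
      using XV card_X finV V0_def by (metis card_Diff_subset card_mono finite_Diff
          finite_subset le_add_diff_inverse2)
    then have large: "d \<le> card (V0 - X)" using card_V0 card_M0 size by linarith
    obtain c where c: "d - card (V0 - X - \<Union>L) = 2 * c" using L(3) by blast
    have missL: "card (V0 - X - \<Union>L) + 2 * card L = card (V0 - X)"
      using g.card_missed[OF L(1) finVX] .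
    \<comment> \<open>Each discarded edge raises the defect by 2, so dropping \<open>c\<close> edges
      makes it exactly \<open>d\<close>; \<open>large\<close> ensures that \<open>L\<close> has that
      many.\<close>
    obtain L0 where L0: "L0 \<subseteq> L" "card L0 = card L - c"
      by (meson diff_le_self obtain_subset_with_card_n)
    have mL0: "g.matching_in (V0 - X) L0" using g.matching_in_subset[OF L(1) L0(1)] .
    have "c \<le> card L" using c missL large L(2) by linarith
    then have dL0: "card (V0 - X - \<Union>L0) = d"
      using g.card_missed[OF mL0 finVX] missL c L(2) L0(2) by linarith
    have UM: "\<Union>M = {x, y} \<union> \<Union>M0" using True M0_def by blast
    have eq: "V0 - X = ?V - S - \<Union>M" unfolding V0_def X_def UM by blast
    have "h.matching_in (?V - S) (M \<union> L0)"
      using h.matching_in_Un[OF M(1)] lift[OF mL0] eq by simp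
    moreover have "?V - S - \<Union>(M \<union> L0) = V0 - X - \<Union>L0" unfolding eq by blast
    ultimately show ?thesis using dL0 by (intro exI[of _ "M \<union> L0"]) simp
  qed
  moreover have "n + 2 * (k - 1) + d + 2 \<le> card ?V" using size by simp
  ultimately show ?thesis unfolding nkd_graph_iff[OF G'] V' using par by simp
qed

end
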